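(* Let $a,b\in\mathbb{R}\setminus\{0\}$, let $\mathcal{C}\subset\mathbb{CP}^2$ be the complex conic with affine equation $\frac{x^2}{a}+\frac{y^2}{b}=1$, and for $\lambda\in\mathbb{C}\setminus\{a,b\}$ let $\mathcal{C}_\lambda$ be the complex conic with affine equation $\frac{x^2}{a-\lambda}+\frac{y^2}{b-\lambda}=1$. Let $T$ be a non-degenerate non-isotropic orbit of $\mathcal{C}$ (with at least one side) which is tangent to $\mathcal{C}_\lambda$, i.e. whose sides are tangent to $\mathcal{C}_\lambda$. Then $\lambda=ab\,P(T)$.
   Context: Use homogeneous coordinates $(x:y:z)$ on $\mathbb{CP}^2$, identify $\mathbb{C}^2$ with $\{z=1\}$, let $L_\infty=\{z=0\}$ and $q(x,y)=x^2+y^2$ on $\mathbb{C}^2$. A point is finite if it lies in $\mathbb{C}^2$. Let $I=(1:i:0)$, $J=(1:-i:0)$; a line is isotropic if it contains $I$ or $J$ (in particular $L_\infty$ is isotropic). For a non-isotropic line $L$, the symmetry with respect to $L$ is the unique non-trivial complex affine involution of $\mathbb{C}^2$ preserving $q$ and fixing the points of $L$; it extends to $\mathbb{CP}^2$ and acts on lines. A non-degenerate orbit on $\mathcal{C}$ is a finite sequence $(p_0,\dots,p_n)$ of points of $\mathcal{C}$ such that $p_j\ne p_{j+1}$ for all $j<n$, every tangent line $T_{p_j}\mathcal{C}$ is non-isotropic, and for $0<j<n$ the lines $p_{j-1}p_j$ and $p_jp_{j+1}$ are symmetric with respect to $T_{p_j}\mathcal{C}$. Its sides are the lines $p_jp_{j+1}$.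 It is non-isotropic if none of its sides is isotropic. For a finite point $p=(x,y)\in\mathbb{C}^2$ and $v=(v_x,v_y)\in\mathbb{C}^2$ with $q(v)\neq0$, put $P(p,v)=\frac{1}{q(v)}\left(\frac{xv_x}{a}+\frac{yv_y}{b}\right)^2$. For a non-degenerate non-isotropic orbit $T=(p_0,\dots,p_n)$ on $\mathcal{C}$, the quantity $P(p_j,v)$ is the same for all finite vertices $p_j$ of $T$ and all vectors $v$ directing a side $p_{j-1}p_j$ or $p_jp_{j+1}$ of $T$; this common value is denoted $P(T)$. *)

theory Defs
  imports "HOL-Analysis.Analysis"
begin

section \<open>The complex projective plane\<close>

definition proportional :: "complex^3 \<Rightarrow> complex^3 \<Rightarrow> bool" where
  "proportional u v \<longleftrightarrow> u \<noteq> 0 \<and> v \<noteq> 0 \<and> (\<exists>c. u = c *s v)"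

lemma part_equivp_proportional: "part_equivp proportional"
proof (rule part_equivpI)
  show "\<exists>x. proportional x x"
    by (rule exI[of _ "axis 1 1"]) (auto simp: proportional_def axis_eq_0_iff intro: exI[of _ 1])
  show "symp proportional"
  proof (rule sympI)
    fix u v assume "proportional u v"
    then obtain c where c: "u \<noteq> 0" "v \<noteq> 0" "u = c *s v" by (auto simp: proportional_def)
    then have "c \<noteq> 0" by auto
    then have "v = inverse c *s u" using c by (simp add: vector_smult_assoc)
    with c show "proportional v u" unfolding proportional_def by blast
  qed
  show "transp proportional"
    by (rule transpI) (force simp: proportional_def vector_smult_assoc)
qed

quotient_type cp2 = "complex^3" / partial: proportional
  by (rule part_equivp_proportional)

text \<open>The point \<open>(x:y:z)\<close> with homogeneous coordinates \<open>v = (x,y,z)\<close>; meaningful only for \<open>v \<noteq> 0\<close>.\<close>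
definition homog :: "complex^3 \<Rightarrow> cp2" where
  "homog v = abs_cp2 v"

lemma cp2_exhaust: obtains v where "v \<noteq> 0" "p = homog v"
proof -
  have "proportional (rep_cp2 p) (rep_cp2 p)"
    using Quotient3_cp2 by (meson Quotient3_rep_reflp)
  then have "rep_cp2 p \<noteq> 0" by (simp add: proportional_def)
  moreover have "p = homog (rep_cp2 p)"
    unfolding homog_def using Quotient3_cp2 by (simp add: Quotient3_abs_rep)
  ultimately show thesis using that by blast
qed

lemma proportional_refl: "v \<noteq> 0 \<Longrightarrow> proportional v v"
  unfolding proportional_def by (auto intro: exI[of _ 1])

lemma homog_eq_iff:
  assumes "u \<noteq> 0" "v \<noteq> 0"
  shows "homog u = homog v \<longleftrightarrow> (\<exists>c. u = c *s v)"
  unfolding homog_def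
  using Quotient3_rel[OF Quotient3_cp2, of u v] assms proportional_refl
  by (auto simp: proportional_def)

lift_definition incident :: "complex^3 \<Rightarrow> cp2 \<Rightarrow> bool"
  is "\<lambda>l v. l$1 * v$1 + l$2 * v$2 + l$3 * v$3 = 0"
proof -
  fix l u v :: "complex^3" assume "proportional u v"
  then obtain c where c: "c \<noteq> 0" "u = c *s v" by (auto simp: proportional_def)
  have "l$1 * u$1 + l$2 * u$2 + l$3 * u$3 = c * (l$1 * v$1 + l$2 * v$2 + l$3 * v$3)"
    by (simp add: c algebra_simps)
  then show "(l$1 * u$1 + l$2 * u$2 + l$3 * u$3 = 0) = (l$1 * v$1 + l$2 * v$2 + l$3 * v$3 = 0)"
    using c by simp
qed

lemma incident_homog:
  assumes "v \<noteq> 0"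
  shows "incident l (homog v) \<longleftrightarrow> l$1 * v$1 + l$2 * v$2 + l$3 * v$3 = 0"
  unfolding homog_def using assms by (simp add: incident.abs_eq proportional_refl eq_onp_def)

definition is_line :: "cp2 set \<Rightarrow> bool" where
  "is_line L \<longleftrightarrow> (\<exists>l. l \<noteq> 0 \<and> L = {p. incident l p})"

definition line_through :: "cp2 \<Rightarrow> cp2 \<Rightarrow> cp2 set" where
  "line_through p p' = (THE L. is_line L \<and> p \<in> L \<and> p' \<in> L)"

lemma ex1_line_through:
  assumes "p \<noteq> p'"
  shows "\<exists>!L. is_line L \<and> p \<in> L \<and> p' \<in> L"
proof -
  obtain u v where uv: "u \<noteq> 0" "p = homog u" "v \<noteq> 0" "p' = homog v"
    by (metis cp2_exhaust)
  define n :: "complex^3" where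
    "n = vector [u$2* v$3 - u$3* v$2, u$3* v$1 - u$1* v$3, u$1* v$2 - u$2* v$1]"
  have np: "\<not> (\<exists>c. u = c *s v)" using assms uv homog_eq_iff by auto
  have n0: "n \<noteq> 0"
  proof
    assume "n = 0"
    then have e: "u$2* v$3 = u$3* v$2" "u$3* v$1 = u$1* v$3" "u$1* v$2 = u$2* v$1"
      by (auto simp: n_def vec_eq_iff forall_3)
    consider "v$1 \<noteq> 0" | "v$2 \<noteq> 0" | "v$3 \<noteq> 0" using uv by (auto simp: vec_eq_iff forall_3)
    then show False
    proof cases
      case 1 then have "u = (u$1/v$1) *s v" using e by (auto simp: vec_eq_iff forall_3 field_simps)
      then show ?thesis using np by blast
    next
      case 2 then have "u = (u$2/v$2) *s v" using e by (auto simp: vec_eq_iff forall_3 field_simps)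
      then show ?thesis using np by blast
    next
      case 3 then have "u = (u$3/v$3) *s v" using e by (auto simp: vec_eq_iff forall_3 field_simps)
      then show ?thesis using np by blast
    qed
  qed
  show ?thesis
  proof (rule ex1I[of _ "{x. incident n x}"])
    show "is_line {x. incident n x} \<and> p \<in> {x. incident n x} \<and> p' \<in> {x. incident n x}"
      using n0 uv by (auto simp: is_line_def incident_homog n_def algebra_simps)
  next
    fix L assume L: "is_line L \<and> p \<in> L \<and> p' \<in> L"
    then obtain l where l: "l \<noteq> 0" "L = {x. incident l x}" by (auto simp: is_line_def)
    have a: "l$1 * u$1 + l$2 * u$2 + l$3 * u$3 = 0" "l$1 * v$1 + l$2 * v$2 + l$3 * v$3 = 0"
      using L l uv by (auto simp: incident_homog)
    have c: "l$1*n$2 = l$2*n$1" "l$1*n$3 = l$3*n$1" "l$2*n$3 = l$3*n$2"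
      using a by (simp_all add: n_def, algebra+)
    have "\<exists>k. n = k *s l"
    proof -
      consider "l$1 \<noteq> 0" | "l$2 \<noteq> 0" | "l$3 \<noteq> 0" using l by (auto simp: vec_eq_iff forall_3)
      then show ?thesis
      proof cases
        case 1 then have "n = (n$1/l$1) *s l" using c by (auto simp: vec_eq_iff forall_3 field_simps)
        then show ?thesis by blast
      next
        case 2 then have "n = (n$2/l$2) *s l" using c by (auto simp: vec_eq_iff forall_3 field_simps)
        then show ?thesis by blast
      next
        case 3 then have "n = (n$3/l$3) *s l" using c by (auto simp: vec_eq_iff forall_3 field_simps)
        then show ?thesis by blast
      qed
    qed
    then obtain k where k: "n = k *s l" by blast
    then have k0: "k \<noteq> 0" using n0 by auto
    have "incident l x = incident n x" for x
    proof -
      obtain w where w: "w \<noteq> 0" "x = homog w" by (rule cp2_exhaust)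
      have "n$1 * w$1 + n$2 * w$2 + n$3 * w$3 = k * (l$1 * w$1 + l$2 * w$2 + l$3 * w$3)"
        by (simp add: k algebra_simps)
      then show ?thesis using w k0 by (simp add: incident_homog)
    qed
    then show "L = {x. incident n x}" using l by auto
  qed
qed

definition affine_point :: "complex^2 \<Rightarrow> cp2" where
  "affine_point u = homog (vector [u$1, u$2, 1])"

lemma affine_vec_nonzero: "vector [x, y, 1] \<noteq> (0 :: complex^3)"
  by (auto simp: vec_eq_iff forall_3)

lemma affine_point_inj: "affine_point u = affine_point u' \<longleftrightarrow> u = u'"
  by (auto simp: affine_point_def homog_eq_iff affine_vec_nonzero vec_eq_iff forall_3 forall_2)

definition point_I :: cp2 where "point_I = homog (vector [1, \<i>, 0])"
definition point_J :: cp2 where "point_J = homog (vector [1, -\<i>, 0])"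

definition isotropic :: "cp2 set \<Rightarrow> bool" where
  "isotropic L \<longleftrightarrow> is_line L \<and> (point_I \<in> L \<or> point_J \<in> L)"

text \<open>\<open>v\<close> directs \<open>L\<close> (a line other than the line at infinity) if \<open>v\<close> is nonzero
  and \<open>L\<close> passes through the point at infinity \<open>(v\<^sub>x:v\<^sub>y:0)\<close>.\<close>
definition directs :: "complex^2 \<Rightarrow> cp2 set \<Rightarrow> bool" where
  "directs v L \<longleftrightarrow> v \<noteq> 0 \<and> homog (vector [v$1, v$2, 0]) \<in> L"


section \<open>Symmetry with respect to a line\<close>

definition q :: "complex^2 \<Rightarrow> complex" where
  "q v = (v$1)\<^sup>2 + (v$2)\<^sup>2"

text \<open>An affine map preserves the quadratic form \<open>q\<close> if its linear part does.\<close>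
definition is_symmetry :: "cp2 set \<Rightarrow> (complex^2 \<Rightarrow> complex^2) \<Rightarrow> bool" where
  "is_symmetry L s \<longleftrightarrow>
     (\<exists>(A :: complex^2^2) t. (\<forall>u. s u = A *v u + t) \<and> (\<forall>v. q (A *v v) = q v)) \<and>
     s \<circ> s = id \<and> s \<noteq> id \<and>
     (\<forall>u. affine_point u \<in> L \<longrightarrow> s u = u)"

lemma ex1_symmetry:
  assumes "is_line L" "\<not> isotropic L"
  shows "\<exists>!s. is_symmetry L s"
proof -
  obtain l where l: "l \<noteq> 0" "L = {x. incident l x}" using assms by (auto simp: is_line_def)
  have I: "vector [1, \<i>, 0] \<noteq> (0::complex^3)" "vector [1, -\<i>, 0] \<noteq> (0::complex^3)"
    by (auto simp: vec_eq_iff forall_3)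
  have "l$1 + l$2 * \<i> \<noteq> 0" "l$1 - l$2 * \<i> \<noteq> 0"
    using assms l I by (auto simp: isotropic_def point_I_def point_J_def incident_homog)
  moreover have "(l$1)\<^sup>2 + (l$2)\<^sup>2 = (l$1 + l$2 * \<i>) * (l$1 - l$2 * \<i>)"
    by (simp add: algebra_simps power2_eq_square)
  ultimately have Q0: "(l$1)\<^sup>2 + (l$2)\<^sup>2 \<noteq> 0" by simp
  define Q where "Q = (l$1)\<^sup>2 + (l$2)\<^sup>2"
  have Q: "Q \<noteq> 0" using Q0 Q_def by simp
  have mem: "affine_point u \<in> L \<longleftrightarrow> l$1 * u$1 + l$2 * u$2 + l$3 = 0" for u
    by (simp add: l affine_point_def incident_homog affine_vec_nonzero)
  define r :: "complex^2 \<Rightarrow> complex^2" where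
    "r u = vector [u$1 - 2 * l$1 * (l$1*u$1 + l$2*u$2 + l$3) / Q,
                   u$2 - 2 * l$2 * (l$1*u$1 + l$2*u$2 + l$3) / Q]" for u
  show ?thesis
  proof (rule ex1I[of _ r])
    define A :: "complex^2^2" where
      "A = vector [vector [1 - 2*l$1*l$1/Q, - 2*l$1*l$2/Q], vector [- 2*l$1*l$2/Q, 1 - 2*l$2*l$2/Q]]"
    define t :: "complex^2" where "t = vector [- 2*l$1*l$3/Q, - 2*l$2*l$3/Q]"
    have 1: "r u = A *v u + t" for u
      using Q by (simp add: r_def A_def t_def matrix_vector_mult_def vec_eq_iff forall_2 sum_2 field_simps)
    have 2: "q (A *v v) = q v" for v
    proof -
      have "Q^2 * (q (A *v v) - q v) = 0"
        using Q unfolding q_def A_def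
        apply (simp add: matrix_vector_mult_def sum_2 field_simps)
        unfolding Q_def by algebra
      then show ?thesis using Q by simp
    qed
    have 3: "r (r u) = u" for u
      using Q apply (simp add: r_def vec_eq_iff forall_2 field_simps)
      unfolding Q_def by algebra
    have 4: "r \<noteq> id"
    proof
      assume "r = id"
      have eq: "l$1 * u$1 + l$2 * u$2 + l$3 = 0" for u :: "complex^2"
      proof -
        have "r u = u" using \<open>r = id\<close> by simp
        then have "l$1 * (l$1 * u$1 + l$2 * u$2 + l$3) = 0" "l$2 * (l$1 * u$1 + l$2 * u$2 + l$3) = 0"
          using Q by (auto simp: r_def vec_eq_iff forall_2)
        then show ?thesis using Q Q_def by auto
      qed
      show False using eq[of 0] eq[of "vector [1,0]"] eq[of "vector [0,1]"] Q Q_def by simp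
    qed
    show "is_symmetry L r"
      unfolding is_symmetry_def
    proof (intro conjI)
      show "\<exists>A t. (\<forall>u. r u = A *v u + t) \<and> (\<forall>v. q (A *v v) = q v)" using 1 2 by blast
      show "\<forall>u. affine_point u \<in> L \<longrightarrow> r u = u"
        by (simp add: mem r_def vec_eq_iff forall_2)
    qed (use 3 4 in auto)
  next
    fix s assume s: "is_symmetry L s"
    then obtain A t where At: "\<And>u. s u = A *v u + t" "\<And>v. q (A *v v) = q v"
      and ne: "s \<noteq> id" and fx: "\<And>u. affine_point u \<in> L \<Longrightarrow> s u = u"
      unfolding is_symmetry_def by blast
    define n d u0 :: "complex^2" where "n = vector [l$1, l$2]" and "d = vector [- l$2, l$1]"
      and "u0 = vector [- l$3 * l$1 / Q, - l$3 * l$2 / Q]"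
    have "affine_point u0 \<in> L" "affine_point (u0 + d) \<in> L"
      using Q by (simp_all add: mem u0_def d_def field_simps)
         (simp_all add: Q_def algebra_simps power2_eq_square)
    then have f0: "A *v u0 + t = u0" and f1: "A *v (u0 + d) + t = u0 + d"
      using fx At by metis+
    then have Ad: "A *v d = d"
      by (metis (no_types, lifting) add.commute add.left_commute add_left_cancel matrix_vector_right_distrib)
    define w where "w = A *v n"
    have q1: "q w = Q" using At(2)[of n] by (simp add: w_def q_def n_def Q_def)
    have q2: "q (w + d) = q (n + d)" using At(2)[of "n + d"] Ad by (simp add: w_def matrix_vector_right_distrib)
    have e1: "(w$1)\<^sup>2 + (w$2)\<^sup>2 = Q" using q1 by (simp add: q_def)
    have e2: "w$2 * l$1 = w$1 * l$2"
    proof -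
      have "(w$1 - l$2)\<^sup>2 + (w$2 + l$1)\<^sup>2 = (l$1 - l$2)\<^sup>2 + (l$2 + l$1)\<^sup>2"
        using q2 by (simp add: q_def n_def d_def)
      then have "2 * (w$2 * l$1 - w$1 * l$2) = 0" using e1 Q_def by algebra
      then show ?thesis by simp
    qed
    define k where "k = (w$1 * l$1 + w$2 * l$2) / Q"
    have wk: "w = k *s n"
    proof -
      have "Q * w$1 = (w$1 * l$1 + w$2 * l$2) * l$1" "Q * w$2 = (w$1 * l$1 + w$2 * l$2) * l$2"
        using e2 unfolding Q_def by algebra+
      then show ?thesis using Q by (simp add: k_def n_def vec_eq_iff forall_2 field_simps)
    qed
    have "k\<^sup>2 * Q = Q" using e1 wk by (simp add: n_def Q_def power_mult_distrib distrib_left)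
    then have k: "k = 1 \<or> k = -1" using Q by (simp add: power2_eq_1_iff)
    have dec: "u = u0 + ((l$1*u$1 + l$2*u$2 + l$3)/Q) *s n + ((l$1*u$2 - l$2*u$1)/Q) *s d" for u
      using Q apply (simp add: u0_def n_def d_def vec_eq_iff forall_2 field_simps)
      unfolding Q_def by algebra
    have su: "s u = u0 + (k * ((l$1*u$1 + l$2*u$2 + l$3)/Q)) *s n + ((l$1*u$2 - l$2*u$1)/Q) *s d" for u
    proof -
      have *: "A *v (c *s x) = c *s (A *v x)" for c x
        by (simp add: matrix_vector_mult_def vec_eq_iff forall_2 sum_2 algebra_simps)
      have "s u = A *v (u0 + ((l$1*u$1 + l$2*u$2 + l$3)/Q) *s n + ((l$1*u$2 - l$2*u$1)/Q) *s d) + t"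
        unfolding At(1) using dec[of u] by simp
      also have "\<dots> = (A *v u0 + t) + ((l$1*u$1 + l$2*u$2 + l$3)/Q) *s w + ((l$1*u$2 - l$2*u$1)/Q) *s d"
        by (simp add: matrix_vector_right_distrib * Ad w_def[symmetric])
      also have "\<dots> = u0 + (k * ((l$1*u$1 + l$2*u$2 + l$3)/Q)) *s n + ((l$1*u$2 - l$2*u$1)/Q) *s d"
        by (simp add: f0 wk vector_smult_assoc mult.commute)
      finally show ?thesis .
    qed
    have "k \<noteq> 1"
    proof
      assume "k = 1"
      then have "s u = u" for u using su[of u] dec[of u] by simp
      then show False using ne by auto
    qed
    then have k: "k = -1" using k by simp
    show "s = r"
    proof
      fix u
      show "s u = r u"
        using Q unfolding su k
        apply (simp add: r_def u0_def n_def d_def vec_eq_iff forall_2 field_simps)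
        unfolding Q_def by algebra
    qed
  qed
qed

definition projective_extension :: "(complex^2 \<Rightarrow> complex^2) \<Rightarrow> (cp2 \<Rightarrow> cp2) \<Rightarrow> bool" where
  "projective_extension s g \<longleftrightarrow>
     (\<exists>M :: complex^3^3. invertible M \<and> (\<forall>v. v \<noteq> 0 \<longrightarrow> g (homog v) = homog (M *v v))) \<and>
     (\<forall>u. g (affine_point u) = affine_point (s u))"

lemma ex1_projective_extension:
  assumes "is_symmetry L s"
  shows "\<exists>!g. projective_extension s g"
proof -
  obtain A t where At: "\<And>u. s u = A *v u + t" and ss: "s \<circ> s = id"
    using assms unfolding is_symmetry_def by blast
  define M :: "complex^3^3" where
    "M = vector [vector [A$1$1, A$1$2, t$1], vector [A$2$1, A$2$2, t$2], vector [0, 0, 1]]"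
  have Mv: "M *v v = vector [A$1$1* v$1 + A$1$2* v$2 + t$1* v$3, A$2$1* v$1 + A$2$2* v$2 + t$2* v$3, v$3]" for v
    by (simp add: M_def matrix_vector_mult_def vec_eq_iff forall_3 sum_3)
  have s12: "s u $ 1 = A$1$1*u$1 + A$1$2*u$2 + t$1" "s u $ 2 = A$2$1*u$1 + A$2$2*u$2 + t$2" for u
    by (simp_all add: At matrix_vector_mult_def sum_2)
  have ssu: "s (s u) = u" for u using ss by (metis comp_apply id_apply)
  have c: "A$1$1*(s u$1) + A$1$2*(s u$2) + t$1 = u$1" "A$2$1*(s u$1) + A$2$2*(s u$2) + t$2 = u$2" for u
    using s12[of "s u"] ssu[of u] by simp_all
  note c0 = c[of 0, unfolded s12, simplified]
  note c1 = c[of "vector [1,0]", unfolded s12, simplified]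
  note c2 = c[of "vector [0,1]", unfolded s12, simplified]
  have a: "A$1$1*A$1$1 + A$1$2*A$2$1 = 1" "A$1$1*A$1$2 + A$1$2*A$2$2 = 0"
    "A$2$1*A$1$1 + A$2$2*A$2$1 = 0" "A$2$1*A$1$2 + A$2$2*A$2$2 = 1"
    using c0 c1 c2 by algebra+
  have "M ** M = mat 1"
    using a c0 by (simp add: M_def matrix_matrix_mult_def mat_def vec_eq_iff forall_3 sum_3)
  then have inv: "invertible M" unfolding invertible_def by blast
  have inv0: "N *v v \<noteq> 0" if "invertible N" "v \<noteq> 0" for N :: "complex^3^3" and v
    using that by (metis invertible_def matrix_vector_mul_assoc matrix_vector_mul_lid matrix_vector_mult_0_right)
  have lin: "N *v (c *s x) = c *s (N *v x)" for c x and N :: "complex^3^3"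
    by (simp add: matrix_vector_mult_def vec_eq_iff forall_3 sum_3 algebra_simps)
  define g where "g p = homog (M *v rep_cp2 p)" for p
  have rp: "rep_cp2 p \<noteq> 0" "homog (rep_cp2 p) = p" for p
  proof -
    have "proportional (rep_cp2 p) (rep_cp2 p)"
      using Quotient3_cp2 by (meson Quotient3_rep_reflp)
    then show "rep_cp2 p \<noteq> 0" by (simp add: proportional_def)
    show "homog (rep_cp2 p) = p"
      unfolding homog_def using Quotient3_cp2 by (simp add: Quotient3_abs_rep)
  qed
  have g: "g (homog v) = homog (M *v v)" if v0: "v \<noteq> 0" for v
  proof -
    obtain c where "rep_cp2 (homog v) = c *s v"
      using homog_eq_iff[of "rep_cp2 (homog v)" v] rp v0 by auto
    then show ?thesis
      unfolding g_def using homog_eq_iff inv0[OF inv] rp(1)[of "homog v"] v0 lin by metis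
  qed
  show ?thesis
  proof (rule ex1I[of _ g])
    show "projective_extension s g"
      unfolding projective_extension_def
      using inv g by (auto simp: affine_point_def affine_vec_nonzero Mv s12 intro!: exI[of _ M])
  next
    fix h assume "projective_extension s h"
    then obtain N where N: "invertible N" "\<And>v. v \<noteq> 0 \<Longrightarrow> h (homog v) = homog (N *v v)"
      and hs: "\<And>u. h (affine_point u) = affine_point (s u)"
      unfolding projective_extension_def by blast
    have ex: "\<exists>c. N *v vector [x, y, 1] = c *s (M *v vector [x, y, 1])" for x y
    proof -
      have nz: "vector [x,y,1] \<noteq> (0::complex^3)" by (rule affine_vec_nonzero)
      have "homog (N *v vector [x,y,1]) = h (affine_point (vector [x,y]))"
        using N(2)[OF nz] by (simp add: affine_point_def)
      also have "\<dots> = homog (M *v vector [x,y,1])"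
        unfolding hs by (simp add: affine_point_def Mv s12)
      finally show ?thesis using homog_eq_iff inv0 inv N(1) nz by metis
    qed
    define K where "K = M ** N"
    have MM: "M *v (M *v v) = v" for v
      using \<open>M ** M = mat 1\<close> by (simp add: matrix_vector_mul_assoc)
    have Kv: "K *v v = M *v (N *v v)" for v by (simp add: K_def matrix_vector_mul_assoc)
    have exK: "\<exists>c. K *v vector [x, y, 1] = c *s vector [x, y, 1]" for x y
      using ex[of x y] by (auto simp: Kv lin MM)
    have K: "K$1$1*x + K$1$2*y + K$1$3 = (K$3$1*x + K$3$2*y + K$3$3) * x"
       "K$2$1*x + K$2$2*y + K$2$3 = (K$3$1*x + K$3$2*y + K$3$3) * y" for x y
      using exK[of x y] by (auto simp: matrix_vector_mult_def sum_3 vec_eq_iff forall_3)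
    note z = K[of 0 0, simplified] K[of 1 0, simplified] K[of "-1" 0, simplified] K[of 0 1, simplified]
       K[of 0 "-1", simplified] K[of 1 1, simplified]
    have k: "K$1$3 = 0" "K$2$3 = 0" "K$2$1 = 0" "K$1$2 = 0" using z by auto
    have k': "K$1$1 = K$3$1 + K$3$3" "K$1$1 = K$3$3 - K$3$1" using z k by (auto simp: algebra_simps)
    then have "2 * K$3$1 = 0" by algebra
    then have k2: "K$3$1 = 0" by simp
    have k'': "K$2$2 = K$3$2 + K$3$3" "K$2$2 = K$3$3 - K$3$2" using z k by (auto simp: algebra_simps)
    then have "2 * K$3$2 = 0" by algebra
    then have k3: "K$3$2 = 0" by simp
    have Ks: "K *v v = K$3$3 *s v" for v
      using k k' k'' k2 k3 by (simp add: matrix_vector_mult_def sum_3 vec_eq_iff forall_3)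
    show "h = g"
    proof
      fix p obtain v where v: "v \<noteq> 0" "p = homog v" by (rule cp2_exhaust)
      have "N *v v = K$3$3 *s (M *v v)" using Ks[of v] MM[of "N *v v"] lin Kv by metis
      then show "h p = g p" using v N(2)[OF v(1)] g[OF v(1)] homog_eq_iff inv0 inv N(1) by metis
    qed
  qed
qed

text \<open>For a non-isotropic line \<open>L\<close> the maps \<open>s\<close> and \<open>g\<close> below exist and are unique, by
  \<open>ex1_symmetry\<close> and \<open>ex1_projective_extension\<close>.\<close>
definition symmetric_lines :: "cp2 set \<Rightarrow> cp2 set \<Rightarrow> cp2 set \<Rightarrow> bool" where
  "symmetric_lines L l m \<longleftrightarrow> (\<exists>s g. is_symmetry L s \<and> projective_extension s g \<and> g ` l = m)"


section \<open>Conics\<close>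

definition conic_form :: "complex \<Rightarrow> complex \<Rightarrow> complex^3 \<Rightarrow> complex" where
  "conic_form \<alpha> \<beta> v = (v$1)\<^sup>2 / \<alpha> + (v$2)\<^sup>2 / \<beta> - (v$3)\<^sup>2"

definition conic_gradient :: "complex \<Rightarrow> complex \<Rightarrow> complex^3 \<Rightarrow> complex^3" where
  "conic_gradient \<alpha> \<beta> v = vector [2 * v$1 / \<alpha>, 2 * v$2 / \<beta>, - 2 * v$3]"

lemma conic_form_has_derivative:
  "(conic_form \<alpha> \<beta> has_derivative
     (\<lambda>w. conic_gradient \<alpha> \<beta> v $ 1 * w$1 + conic_gradient \<alpha> \<beta> v $ 2 * w$2
        + conic_gradient \<alpha> \<beta> v $ 3 * w$3)) (at v)"
  unfolding conic_form_def conic_gradient_def divide_inverse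
  by (auto intro!: derivative_eq_intros bounded_linear_imp_has_derivative bounded_linear_vec_nth
        simp: fun_eq_iff algebra_simps)

lift_definition on_conic :: "complex \<Rightarrow> complex \<Rightarrow> cp2 \<Rightarrow> bool"
  is "\<lambda>\<alpha> \<beta> v. conic_form \<alpha> \<beta> v = 0"
proof -
  fix \<alpha> \<beta> :: complex and u v :: "complex^3" assume "proportional u v"
  then obtain c where c: "c \<noteq> 0" "u = c *s v" by (auto simp: proportional_def)
  have "conic_form \<alpha> \<beta> u = c\<^sup>2 * conic_form \<alpha> \<beta> v"
    by (simp add: c conic_form_def algebra_simps power2_eq_square)
  then show "(conic_form \<alpha> \<beta> u = 0) = (conic_form \<alpha> \<beta> v = 0)"
    using c by simp
qed

text \<open>The projective conic with affine equation \<open>x\<^sup>2 / \<alpha> + y\<^sup>2 / \<beta> = 1\<close>, for nonzero \<open>\<alpha>\<close>, \<open>\<beta>\<close>.\<close>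
definition conic :: "complex \<Rightarrow> complex \<Rightarrow> cp2 set" where
  "conic \<alpha> \<beta> = {p. on_conic \<alpha> \<beta> p}"

lift_definition on_tangent :: "complex \<Rightarrow> complex \<Rightarrow> cp2 \<Rightarrow> cp2 \<Rightarrow> bool"
  is "\<lambda>\<alpha> \<beta> v w. conic_gradient \<alpha> \<beta> v $ 1 * w$1 + conic_gradient \<alpha> \<beta> v $ 2 * w$2
        + conic_gradient \<alpha> \<beta> v $ 3 * w$3 = 0"
proof -
  fix \<alpha> \<beta> :: complex and u v u' v' :: "complex^3"
  let ?B = "\<lambda>v w. conic_gradient \<alpha> \<beta> v $ 1 * w$1 + conic_gradient \<alpha> \<beta> v $ 2 * w$2
        + conic_gradient \<alpha> \<beta> v $ 3 * w$3"
  assume "proportional u v" "proportional u' v'"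
  then obtain c c' where c: "c \<noteq> 0" "u = c *s v" "c' \<noteq> 0" "u' = c' *s v'"
    by (auto simp: proportional_def)
  have "?B u u' = c * c' * ?B v v'"
    by (simp add: c conic_gradient_def algebra_simps)
  then show "(?B u u' = 0) = (?B v v' = 0)"
    using c by simp
qed

definition tangent_line :: "complex \<Rightarrow> complex \<Rightarrow> cp2 \<Rightarrow> cp2 set" where
  "tangent_line \<alpha> \<beta> p = {p'. on_tangent \<alpha> \<beta> p p'}"

definition line_tangent_to_conic :: "cp2 set \<Rightarrow> complex \<Rightarrow> complex \<Rightarrow> bool" where
  "line_tangent_to_conic L \<alpha> \<beta> \<longleftrightarrow> (\<exists>p \<in> conic \<alpha> \<beta>. L = tangent_line \<alpha> \<beta> p)"


section \<open>Billiard orbits\<close>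

definition side :: "cp2 list \<Rightarrow> nat \<Rightarrow> cp2 set" where
  "side T j = line_through (T ! j) (T ! Suc j)"

definition sides :: "cp2 list \<Rightarrow> cp2 set set" where
  "sides T = {side T j | j. Suc j < length T}"

definition nondegenerate_orbit :: "complex \<Rightarrow> complex \<Rightarrow> cp2 list \<Rightarrow> bool" where
  "nondegenerate_orbit \<alpha> \<beta> T \<longleftrightarrow>
     T \<noteq> [] \<and> set T \<subseteq> conic \<alpha> \<beta> \<and>
     (\<forall>j. Suc j < length T \<longrightarrow> T ! j \<noteq> T ! Suc j) \<and>
     (\<forall>p \<in> set T. \<not> isotropic (tangent_line \<alpha> \<beta> p)) \<and>
     (\<forall>j. 0 < j \<and> Suc j < length T \<longrightarrow>
        symmetric_lines (tangent_line \<alpha> \<beta> (T ! j)) (side T (j - 1)) (side T j))"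

definition nonisotropic_orbit :: "cp2 list \<Rightarrow> bool" where
  "nonisotropic_orbit T \<longleftrightarrow> (\<forall>L \<in> sides T. \<not> isotropic L)"

definition P_vertex :: "complex \<Rightarrow> complex \<Rightarrow> complex^2 \<Rightarrow> complex^2 \<Rightarrow> complex" where
  "P_vertex \<alpha> \<beta> p v = 1 / q v * (p$1 * v$1 / \<alpha> + p$2 * v$2 / \<beta>)\<^sup>2"

text \<open>The common value of \<open>P\<close> over all finite vertices and all vectors directing a side adjacent to
  them; meaningful for non-degenerate non-isotropic orbits with at least one side. Such an orbit has
  a finite vertex, since two distinct points at infinity span an isotropic side.\<close>
definition P_orbit :: "complex \<Rightarrow> complex \<Rightarrow> cp2 list \<Rightarrow> complex" where
  "P_orbit \<alpha> \<beta> T = (THE c. \<forall>j p v.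
     j < length T \<and> T ! j = affine_point p \<and>
     (0 < j \<and> directs v (side T (j - 1)) \<or> Suc j < length T \<and> directs v (side T j))
     \<longrightarrow> P_vertex \<alpha> \<beta> p v = c)"

end

theory Submission
  imports Defs
begin

text \<open>Let \<open>p\<close> be a finite vertex and \<open>v\<close> a vector directing a side at \<open>p\<close>. The line
  through \<open>p = (x, y)\<close> directed by \<open>v\<close> has coordinates \<open>(v\<^sub>y : - v\<^sub>x : v\<^sub>x y - v\<^sub>y x)\<close>, and the lines tangent
  to \<open>\<C>\<^sub>\<lambda>\<close> satisfy the equation \<open>(a - \<lambda>) m\<^sub>1\<^sup>2 + (b - \<lambda>) m\<^sub>2\<^sup>2 = m\<^sub>3\<^sup>2\<close> of the dual conic. In a confocal
  family this equation is affine in \<open>\<lambda>\<close>, the coefficient of \<open>\<lambda>\<close> being \<open>- q(v)\<close>: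
  \<open>\<lambda> q(v) = b v\<^sub>x\<^sup>2 + a v\<^sub>y\<^sup>2 - (v\<^sub>x y - v\<^sub>y x)\<^sup>2\<close>.
  Since \<open>p\<close> lies on \<open>\<C>\<close>, the right-hand side is \<open>a b (x v\<^sub>x / a + y v\<^sub>y / b)\<^sup>2\<close>. Hence every term entering
  the definition of \<open>P(T)\<close> equals \<open>\<lambda> / (a b)\<close> (\<open>P_vertex_of_tangent_side\<close>). This value is the unique
  one described by \<open>P(T)\<close> as soon as one such term exists, and the first side supplies one: it is not
  the line at infinity, so it has a direction vector and a finite end point.\<close>

lemma line_through_properties:
  assumes "p \<noteq> p'"
  shows "is_line (line_through p p')" "p \<in> line_through p p'" "p' \<in> line_through p p'"
  using theI'[OF ex1_line_through[OF assms]] unfolding line_through_def by auto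

lemma line_through_unique:
  assumes "p \<noteq> p'" "is_line L" "p \<in> L" "p' \<in> L"
  shows "L = line_through p p'"
  using ex1_line_through[OF assms(1)] assms line_through_properties[OF assms(1)] by blast

lemma vector_at_infinity_eq_0_iff: "vector [x, y, 0] = (0 :: complex^3) \<longleftrightarrow> x = 0 \<and> y = 0"
  by (auto simp: vec_eq_iff forall_3)

lemma directs_incident_iff:
  "directs v {p. incident m p} \<longleftrightarrow> (v$1 \<noteq> 0 \<or> v$2 \<noteq> 0) \<and> m$1 * v$1 + m$2 * v$2 = 0"
proof -
  have "v \<noteq> 0 \<longleftrightarrow> v$1 \<noteq> 0 \<or> v$2 \<noteq> 0"
    by (auto simp: vec_eq_iff forall_2)
  then show ?thesis
    by (auto simp: directs_def incident_homog vector_at_infinity_eq_0_iff)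
qed

text \<open>Over \<open>\<complex>\<close> the form \<open>q\<close> splits into two linear factors, whose zeros are the directions of the
  points \<open>I\<close> and \<open>J\<close>; so dividing by \<open>q v\<close> is legitimate for directions of non-isotropic lines.\<close>
lemma q_direction_nonzero:
  assumes "is_line L" "\<not> isotropic L" "directs v L"
  shows "q v \<noteq> 0"
proof
  have "vector [v$1, v$2, 0] \<noteq> (0 :: complex^3)"
    using assms(3) unfolding vector_at_infinity_eq_0_iff by (auto simp: directs_def vec_eq_iff forall_2)
  note v_homog = homog_eq_iff[OF this]
  assume "q v = 0"
  moreover have "q v = (v$1 - \<i> * v$2) * (v$1 + \<i> * v$2)"
    by (simp add: q_def algebra_simps power2_eq_square)
  ultimately consider "v$1 = \<i> * v$2" | "v$1 = - \<i> * v$2"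
    by (auto simp: eq_neg_iff_add_eq_0)
  then have "homog (vector [v$1, v$2, 0]) = point_J \<or> homog (vector [v$1, v$2, 0]) = point_I"
  proof cases
    case 1
    then have "vector [v$1, v$2, 0] = (\<i> * v$2) *s (vector [1, - \<i>, 0] :: complex^3)"
      by (simp add: vec_eq_iff forall_3 algebra_simps)
    then have "homog (vector [v$1, v$2, 0]) = point_J"
      unfolding point_J_def using v_homog vector_at_infinity_eq_0_iff one_neq_zero by blast
    then show ?thesis ..
  next
    case 2
    then have "vector [v$1, v$2, 0] = (- \<i> * v$2) *s (vector [1, \<i>, 0] :: complex^3)"
      by (simp add: vec_eq_iff forall_3 algebra_simps)
    then have "homog (vector [v$1, v$2, 0]) = point_I"
      unfolding point_I_def using v_homog vector_at_infinity_eq_0_iff one_neq_zero by blast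
    then show ?thesis ..
  qed
  then show False
    using assms by (auto simp: isotropic_def directs_def)
qed

text \<open>The tangent at \<open>(x:y:z)\<close> has coordinates \<open>(2x / \<alpha>, 2y / \<beta>, -2z)\<close>. Inserting them into the
  equation of the dual conic, which has the inverse coefficients, gives four times the equation of
  the conic. Passing to the dual conic eliminates the unknown point of tangency.\<close>
lemma tangent_line_in_dual_conic:
  assumes "line_tangent_to_conic L \<alpha> \<beta>" "\<alpha> \<noteq> 0" "\<beta> \<noteq> 0"
  obtains m where "m \<noteq> 0" "L = {p. incident m p}" "\<alpha> * (m$1)\<^sup>2 + \<beta> * (m$2)\<^sup>2 = (m$3)\<^sup>2"
proof -
  obtain u where u: "u \<noteq> 0" and on: "homog u \<in> conic \<alpha> \<beta>" and L: "L = tangent_line \<alpha> \<beta> (homog u)"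
    using assms(1) unfolding line_tangent_to_conic_def by (metis cp2_exhaust)
  have form: "(u$1)\<^sup>2 / \<alpha> + (u$2)\<^sup>2 / \<beta> = (u$3)\<^sup>2"
    using on u
    by (simp add: conic_def homog_def on_conic.abs_eq proportional_refl eq_onp_def conic_form_def)
  define m where "m = conic_gradient \<alpha> \<beta> u"
  have "m \<noteq> 0"
    using u assms by (auto simp: m_def conic_gradient_def vec_eq_iff forall_3)
  moreover have "on_tangent \<alpha> \<beta> (homog u) p = incident m p" for p
  proof -
    obtain w where "w \<noteq> 0" "p = homog w" by (rule cp2_exhaust)
    then show ?thesis
      using u by (simp add: incident_homog)
        (simp add: homog_def on_tangent.abs_eq proportional_refl eq_onp_def m_def)
  qed
  then have "L = {p. incident m p}"
    by (simp add: L tangent_line_def)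
  moreover have "\<alpha> * (m$1)\<^sup>2 + \<beta> * (m$2)\<^sup>2 = 4 * ((u$1)\<^sup>2 / \<alpha> + (u$2)\<^sup>2 / \<beta>)"
    using assms by (simp add: m_def conic_gradient_def power2_eq_square field_simps)
  then have "\<alpha> * (m$1)\<^sup>2 + \<beta> * (m$2)\<^sup>2 = (m$3)\<^sup>2"
    by (simp add: form) (simp add: m_def conic_gradient_def power2_eq_square)
  ultimately show ?thesis using that by blast
qed

lemma affine_point_on_conic:
  "affine_point p \<in> conic \<alpha> \<beta> \<longleftrightarrow> (p$1)\<^sup>2 / \<alpha> + (p$2)\<^sup>2 / \<beta> = 1"
  by (simp add: conic_def affine_point_def homog_def on_conic.abs_eq proportional_refl
      affine_vec_nonzero eq_onp_def conic_form_def)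

text \<open>The line is known both by its coordinates \<open>m\<close> as a tangent and by the pair \<open>p\<close>, \<open>v\<close>; comparing
  the two descriptions, up to a factor \<open>k\<close>, turns the dual equation into one that is linear in
  \<open>lam\<close>, which is then solved.\<close>
lemma P_vertex_of_tangent_side:
  fixes \<alpha> \<beta> lam :: complex
  assumes nz: "\<alpha> \<noteq> 0" "\<beta> \<noteq> 0" "lam \<noteq> \<alpha>" "lam \<noteq> \<beta>"
    and conic: "affine_point p \<in> conic \<alpha> \<beta>"
    and tangent: "line_tangent_to_conic L (\<alpha> - lam) (\<beta> - lam)"
    and L: "is_line L" "\<not> isotropic L" "affine_point p \<in> L" "directs v L"
  shows "P_vertex \<alpha> \<beta> p v = lam / (\<alpha> * \<beta>)"
proof -
  have qv: "(v$1)\<^sup>2 + (v$2)\<^sup>2 \<noteq> 0"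
    using q_direction_nonzero[OF L(1,2,4)] by (simp add: q_def)
  obtain m where m: "m \<noteq> 0" "L = {p. incident m p}"
    and dual: "(\<alpha> - lam) * (m$1)\<^sup>2 + (\<beta> - lam) * (m$2)\<^sup>2 = (m$3)\<^sup>2"
    using tangent_line_in_dual_conic[OF tangent] nz by auto
  have inc_p: "m$1 * p$1 + m$2 * p$2 + m$3 = 0"
    using L(3) m by (simp add: affine_point_def incident_homog affine_vec_nonzero)
  have inc_v: "m$1 * v$1 + m$2 * v$2 = 0"
    using L(4) unfolding m(2) directs_incident_iff by simp
  obtain k where k: "m$1 = k * v$2" "m$2 = - k * v$1"
  proof (cases "v$2 = 0")
    case False
    then show ?thesis
      using inc_v by (intro that[of "m$1 / v$2"]) (auto simp: field_simps eq_neg_iff_add_eq_0)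
  next
    case True
    then show ?thesis
      using inc_v qv by (intro that[of "- m$2 / v$1"]) auto
  qed
  have m3: "m$3 = k * (v$1 * p$2 - v$2 * p$1)"
    using inc_p k by algebra
  have "k \<noteq> 0"
    using m(1) k m3 by (auto simp: vec_eq_iff forall_3)
  have "k\<^sup>2 * ((\<alpha> - lam) * (v$2)\<^sup>2 + (\<beta> - lam) * (v$1)\<^sup>2) = k\<^sup>2 * (v$1 * p$2 - v$2 * p$1)\<^sup>2"
    using dual unfolding k m3 by algebra
  then have "(\<alpha> - lam) * (v$2)\<^sup>2 + (\<beta> - lam) * (v$1)\<^sup>2 = (v$1 * p$2 - v$2 * p$1)\<^sup>2"
    using \<open>k \<noteq> 0\<close> by simp
  then have lam_eq: "lam * ((v$1)\<^sup>2 + (v$2)\<^sup>2) =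
      \<alpha> * (v$2)\<^sup>2 + \<beta> * (v$1)\<^sup>2 - (v$1 * p$2 - v$2 * p$1)\<^sup>2"
    by algebra
  have on: "\<beta> * (p$1)\<^sup>2 + \<alpha> * (p$2)\<^sup>2 = \<alpha> * \<beta>"
    using conic nz by (simp add: affine_point_on_conic field_simps)
  \<comment> \<open>The equation of \<open>\<C>\<close> turns the right-hand side of \<open>lam_eq\<close> into a perfect square.\<close>
  have "\<alpha> * \<beta> * (lam * ((v$1)\<^sup>2 + (v$2)\<^sup>2)) = (\<beta> * p$1 * v$1 + \<alpha> * p$2 * v$2)\<^sup>2"
    using on unfolding lam_eq by algebra
  moreover have "p$1 * v$1 / \<alpha> + p$2 * v$2 / \<beta> = (\<beta> * p$1 * v$1 + \<alpha> * p$2 * v$2) / (\<alpha> * \<beta>)"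
    using nz by (simp add: field_simps)
  ultimately have "P_vertex \<alpha> \<beta> p v =
      1 / ((v$1)\<^sup>2 + (v$2)\<^sup>2) * (\<alpha> * \<beta> * (lam * ((v$1)\<^sup>2 + (v$2)\<^sup>2)) / (\<alpha> * \<beta>)\<^sup>2)"
    by (simp add: P_vertex_def q_def power_divide)
  then show ?thesis
    using nz qv by (simp add: power2_eq_square)
qed

text \<open>Two distinct points at infinity span the line at infinity, which passes through \<open>I\<close>.\<close>
lemma finite_point_on_nonisotropic_line:
  assumes "p \<noteq> p'" "\<not> isotropic (line_through p p')"
  shows "(\<exists>u. p = affine_point u) \<or> (\<exists>u. p' = affine_point u)"
proof (rule ccontr)
  assume infinite: "\<not> ?thesis"
  define L where "L = {x. incident (vector [0, 0, 1]) x}"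
  have at_infinity: "x \<in> L" if "\<nexists>u. x = affine_point u" for x
  proof -
    obtain w where w: "w \<noteq> 0" "x = homog w" by (rule cp2_exhaust)
    have "w$3 = 0"
    proof (rule ccontr)
      assume "w$3 \<noteq> 0"
      then have "w = w$3 *s (vector [w$1 / w$3, w$2 / w$3, 1] :: complex^3)"
        by (simp add: vec_eq_iff forall_3)
      then have "x = affine_point (vector [w$1 / w$3, w$2 / w$3])"
        using w homog_eq_iff[OF w(1) affine_vec_nonzero] by (auto simp: affine_point_def)
      then show False using that by blast
    qed
    then show ?thesis using w by (simp add: L_def incident_homog)
  qed
  have "is_line L"
    using affine_vec_nonzero by (auto simp: is_line_def L_def)
  moreover from this have "L = line_through p p'"
    using line_through_unique[OF assms(1)] at_infinity infinite by blast
  moreover have "point_I \<in> L"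
    by (simp add: L_def point_I_def incident_homog vector_at_infinity_eq_0_iff)
  ultimately show False
    using assms(2) by (simp add: isotropic_def)
qed

lemma nonisotropic_line_has_direction:
  assumes "is_line L" "\<not> isotropic L"
  shows "\<exists>v. directs v L"
proof -
  obtain l where l: "l \<noteq> 0" "L = {p. incident l p}"
    using assms(1) by (auto simp: is_line_def)
  have nz: "l$2 \<noteq> 0 \<or> l$1 \<noteq> 0"
    using assms l
    by (auto simp: isotropic_def point_I_def incident_homog vector_at_infinity_eq_0_iff)
  then have "directs (vector [l$2, - l$1]) L"
    unfolding l(2) directs_incident_iff by auto
  then show ?thesis by blast
qed

theorem proposition2p32:
  fixes a b :: real and lam :: complex and T :: "cp2 list"
  assumes "a \<noteq> 0" and "b \<noteq> 0"
    and "lam \<noteq> complex_of_real a" and "lam \<noteq> complex_of_real b"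
    and "nondegenerate_orbit (complex_of_real a) (complex_of_real b) T"
    and "nonisotropic_orbit T"
    and "length T \<ge> 2"
    and "\<forall>L \<in> sides T. line_tangent_to_conic L (complex_of_real a - lam) (complex_of_real b - lam)"
  shows "lam = complex_of_real a * complex_of_real b
                 * P_orbit (complex_of_real a) (complex_of_real b) T"
proof -
  define \<alpha> \<beta> where "\<alpha> = complex_of_real a" and "\<beta> = complex_of_real b"
  have nz: "\<alpha> \<noteq> 0" "\<beta> \<noteq> 0" "lam \<noteq> \<alpha>" "lam \<noteq> \<beta>"
    using assms by (auto simp: \<alpha>_def \<beta>_def)
  have distinct: "T ! j \<noteq> T ! Suc j" if "Suc j < length T" for j
    using assms(5) that by (auto simp: nondegenerate_orbit_def)
  have noniso: "\<not> isotropic (side T j)"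
    and tangent: "line_tangent_to_conic (side T j) (\<alpha> - lam) (\<beta> - lam)" if "Suc j < length T" for j
    using assms(6,8) that by (auto simp: nonisotropic_orbit_def sides_def \<alpha>_def \<beta>_def)
  have line: "is_line (side T j)" "T ! j \<in> side T j" "T ! Suc j \<in> side T j"
    if "Suc j < length T" for j
    using line_through_properties[OF distinct[OF that]] by (auto simp: side_def)
  have value_on_side: "P_vertex \<alpha> \<beta> p v = lam / (\<alpha> * \<beta>)"
    if "Suc i < length T" "j = i \<or> j = Suc i" "T ! j = affine_point p" "directs v (side T i)"
    for i j p v
  proof (rule P_vertex_of_tangent_side[OF nz _ tangent line(1) noniso _ that(4)])
    have "T ! j \<in> set T"
      using that(1,2) by (auto intro: nth_mem)
    then show "affine_point p \<in> conic \<alpha> \<beta>"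
      using assms(5) that(3) by (auto simp: nondegenerate_orbit_def \<alpha>_def \<beta>_def)
    show "affine_point p \<in> side T i"
      using line(2,3)[OF that(1)] that(2,3) by auto
  qed (use that(1) in auto)
  have first: "Suc 0 < length T"
    using assms(7) by simp
  obtain v where v: "directs v (side T 0)"
    using nonisotropic_line_has_direction[OF line(1)[OF first] noniso[OF first]] by blast
  obtain j p where jp: "j = 0 \<or> j = Suc 0" "T ! j = affine_point p"
    using finite_point_on_nonisotropic_line[OF distinct[OF first]] noniso[OF first]
    by (auto simp: side_def)
  have "P_orbit \<alpha> \<beta> T = lam / (\<alpha> * \<beta>)"
    unfolding P_orbit_def
  proof (rule the_equality)
    show "\<forall>j p v. j < length T \<and> T ! j = affine_point p \<and>
        (0 < j \<and> directs v (side T (j - 1)) \<or> Suc j < length T \<and> directs v (side T j))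
        \<longrightarrow> P_vertex \<alpha> \<beta> p v = lam / (\<alpha> * \<beta>)"
    proof (intro allI impI, elim conjE disjE)
      fix j p v
      assume "j < length T" "T ! j = affine_point p" "0 < j" "directs v (side T (j - 1))"
      then show "P_vertex \<alpha> \<beta> p v = lam / (\<alpha> * \<beta>)"
        by (intro value_on_side[of "j - 1" j]) auto
    qed (blast intro: value_on_side)
  next
    fix c
    assume "\<forall>j p v. j < length T \<and> T ! j = affine_point p \<and>
        (0 < j \<and> directs v (side T (j - 1)) \<or> Suc j < length T \<and> directs v (side T j))
        \<longrightarrow> P_vertex \<alpha> \<beta> p v = c"
    then have "P_vertex \<alpha> \<beta> p v = c"
      using jp v first by (elim allE[of _ j] allE[of _ p] allE[of _ v]) auto
    then show "c = lam / (\<alpha> * \<beta>)"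
      using value_on_side[OF first jp v] by simp
  qed
  then show ?thesis
    using nz by (simp add: \<alpha>_def[symmetric] \<beta>_def[symmetric])
qed

end
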